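(* Let $a,b,c$ be nonzero real numbers, let $w_0,w_1$ be arbitrary real initial values, and let $\{w_n\}$ be the associated generalized bi-periodic Horadam sequence. Then for all positive integers $n$ and $m$, $$\left(\frac ba\right)^{\zeta(mn+n)}w_{n+1}w_m+\left(\frac ba\right)^{\zeta(mn+m)}c\,w_n w_{m-1}=w_1w_{m+n}+\left(\frac ba\right)^{\zeta(m+n)}c\,w_0w_{m+n-1}.$$
   Context: For nonzero real numbers $a,b,c$ and real initial values $w_0,w_1$, the generalized bi-periodic Horadam sequence $\{w_n\}$ is defined by $w_n=\chi(n)w_{n-1}+c\,w_{n-2}$ for $n\ge 2$, where $\chi(n)=a$ if $n$ is even and $\chi(n)=b$ if $n$ is odd. The parity function is $\zeta(n)=0$ if $n$ is even and $\zeta(n)=1$ if $n$ is odd. *)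

theory Defs
  imports Complex_Main
begin

definition zeta :: "nat \<Rightarrow> nat" where
  "zeta n = (if even n then 0 else 1)"

definition chi :: "real \<Rightarrow> real \<Rightarrow> nat \<Rightarrow> real" where
  "chi a b n = (if even n then a else b)"

fun horadam :: "real \<Rightarrow> real \<Rightarrow> real \<Rightarrow> real \<Rightarrow> real \<Rightarrow> nat \<Rightarrow> real" where
  "horadam a b c w0 w1 0 = w0"
| "horadam a b c w0 w1 (Suc 0) = w1"
| "horadam a b c w0 w1 (Suc (Suc n)) =
     chi a b (Suc (Suc n)) * horadam a b c w0 w1 (Suc n) + c * horadam a b c w0 w1 n"

end

theory Submission
  imports Defs
begin

text \<open>
  The left-hand side is unchanged when \<open>(n, m + 1)\<close> is replaced by \<open>(n + 1, m)\<close>: expand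
  \<open>w (m + 1)\<close> by the recurrence and collect the terms containing \<open>w m\<close> into \<open>w (n + 2)\<close>.
  At \<open>n = 0\<close> the left-hand side is the right-hand side.
\<close>

lemma horadam_shift:
  fixes a b c w0 w1 :: real
  defines "w \<equiv> horadam a b c w0 w1"
  assumes "a \<noteq> 0"
  shows "(b / a) ^ zeta (Suc k * Suc n + Suc n) * w (n + 2) * w (Suc k)
           + (b / a) ^ zeta (Suc k * Suc n + Suc k) * c * w (Suc n) * w k
         = (b / a) ^ zeta (Suc (Suc k) * n + n) * w (Suc n) * w (Suc (Suc k))
           + (b / a) ^ zeta (Suc (Suc k) * n + Suc (Suc k)) * c * w n * w (Suc k)"
  using assms(2)
  \<comment> \<open>Parity fixes every \<open>zeta\<close> and \<open>chi\<close>. On both sides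
    \<open>w (Suc n) * w (Suc k)\<close> then has coefficient \<open>a\<close> if \<open>n\<close>
    and \<open>k\<close> are even, and \<open>b\<close> otherwise.\<close>
  by (cases "even n"; cases "even k") (simp_all add: w_def zeta_def chi_def field_simps)

text \<open>Writing \<open>m = Suc k\<close> turns the index \<open>m - 1\<close> into
  \<open>k\<close>, avoiding truncated subtraction.\<close>

lemma horadam_product_identity:
  fixes a b c w0 w1 :: real
  defines "w \<equiv> horadam a b c w0 w1"
  assumes "a \<noteq> 0"
  shows "(b / a) ^ zeta (Suc k * n + n) * w (Suc n) * w (Suc k)
           + (b / a) ^ zeta (Suc k * n + Suc k) * c * w n * w k
         = w 1 * w (Suc k + n) + (b / a) ^ zeta (Suc k + n) * c * w 0 * w (k + n)"
proof (induction n arbitrary: k)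
  case 0
  then show ?case by (simp add: zeta_def)
next
  case (Suc n)
  show ?case
    \<comment> \<open>Lowering \<open>n\<close> raises \<open>m\<close>, so the hypothesis is needed
      at \<open>Suc k\<close>; the sum \<open>m + n\<close> stays fixed.\<close>
    using horadam_shift[OF assms(2), of b k n c w0 w1] Suc.IH[of "Suc k"]
    unfolding w_def by (simp del: horadam.simps mult_Suc mult_Suc_right)
qed

theorem theorem5:
  fixes a b c w0 w1 :: real and w :: "nat \<Rightarrow> real" and m n :: nat
  assumes "a \<noteq> 0" and "b \<noteq> 0" and "c \<noteq> 0"
    and "w = horadam a b c w0 w1"
    and "n \<ge> 1" and "m \<ge> 1"
  shows "(b / a) ^ zeta (m * n + n) * w (n + 1) * w m
           + (b / a) ^ zeta (m * n + m) * c * w n * w (m - 1)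
         = w 1 * w (m + n) + (b / a) ^ zeta (m + n) * c * w 0 * w (m + n - 1)"
proof -
  obtain k where "m = Suc k"
    using assms(6) by (cases m) auto
  then show ?thesis
    using horadam_product_identity[OF assms(1), of b k n c w0 w1] assms(4)
    by (simp del: horadam.simps mult_Suc mult_Suc_right)
qed

end
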